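(* Let $n\ge 2$ and let $P_1,\dots,P_k$ be alcoved polytopes in $\mathcal{H}_n=\{x\in\mathbb{R}^n : x_1+\dots+x_n=0\}$. Suppose that $P_i$ and $P_j$ are compatible for all $i\neq j\in[k]$. Then the Minkowski sum $P_1+\dots+P_k$ is alcoved.
   Context: A polytope $P\subseteq \mathcal{H}_n$ is called alcoved if it can be written as $P=\{x\in\mathcal{H}_n : x_i-x_j\le a_{i,j}\text{ for all } i\neq j\in[n]\}$ for some real parameters $a_{i,j}$; equivalently, all facet normal directions of $P$ (within $\mathcal{H}_n$) are parallel to roots $e_i-e_j$. Two alcoved polytopes $P,Q\subseteq\mathcal{H}_n$ are called compatible if their Minkowski sum $P+Q$ is again alcoved. *)

theory Defs
  imports "HOL-Analysis.Analysis" "HOL-Library.Set_Algebras"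
begin

text \<open>
  Coordinates are indexed by a finite type with \<open>n\<close> elements. The sum of sets is the
  pointwise one of \<^theory>\<open>HOL-Library.Set_Algebras\<close>, that is, the Minkowski sum.
\<close>

definition sum_zero_hyperplane :: "(real ^ 'n) set" where
  "sum_zero_hyperplane = {x. (\<Sum>i\<in>UNIV. x $ i) = 0}"

definition alcoved :: "(real ^ 'n) set \<Rightarrow> bool" where
  "alcoved P \<longleftrightarrow>
     polytope P \<and> P \<subseteq> sum_zero_hyperplane \<and>
     (\<exists>a :: 'n \<Rightarrow> 'n \<Rightarrow> real.
        P = {x \<in> sum_zero_hyperplane. \<forall>i j. i \<noteq> j \<longrightarrow> x $ i - x $ j \<le> a i j})"

definition compatible :: "(real ^ 'n) set \<Rightarrow> (real ^ 'n) set \<Rightarrow> bool" where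
  "compatible P Q \<longleftrightarrow> alcoved P \<and> alcoved Q \<and> alcoved (P + Q)"

end

theory Submission
  imports Defs
begin

text \<open>
  By induction on the number of summands it suffices to treat three polytopes \<open>P, Q, R\<close>. Their sum is
  alcoved iff its normal cones, intersected with orthants, are generated by roots \<open>e\<^sub>i - e\<^sub>j\<close>, that is
  (Krein--Milman) iff every extreme ray \<open>w\<close> of such an intersection is spanned by a root. Let \<open>L\<^sub>P\<close> be the
  space of sum-zero vectors supported on the support of \<open>w\<close> that are constant on the face of \<open>P\<close>
  maximising \<open>w\<close>, and similarly for \<open>Q\<close> and \<open>R\<close>. Extremality means that \<open>L\<^sub>P \<inter> L\<^sub>Q \<inter> L\<^sub>R\<close> is the line
  through \<open>w\<close>, and compatibility makes the pairwise intersections spanned by roots. A counting argument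
  on the partitions of the coordinates induced by the three spaces then produces a root in the triple
  intersection, which must be a multiple of \<open>w\<close>.
\<close>

section \<open>Roots and subspaces spanned by roots\<close>

definition rootv :: "'n \<Rightarrow> 'n \<Rightarrow> real ^ 'n" where
  "rootv i j = axis i 1 - axis j 1"

lemma root_nth: "rootv i j $ k = (if k = i then 1 else 0) - (if k = j then 1 else 0)"
  by (simp add: rootv_def axis_def)

lemma inner_root: "rootv i j \<bullet> x = x $ i - x $ j"
  by (simp add: rootv_def inner_diff_left inner_axis')

lemma root_self [simp]: "rootv i i = 0"
  by (simp add: rootv_def)

lemma root_add: "rootv i j + rootv j k = rootv i k"
  by (simp add: rootv_def)

lemma uminus_root: "- rootv i j = rootv j i"
  by (simp add: rootv_def)

lemma root_neq_0: "i \<noteq> j \<Longrightarrow> rootv i j \<noteq> 0"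
  by (auto simp: vec_eq_iff root_nth)

lemma sum_root: "finite A \<Longrightarrow> (\<Sum>k\<in>A. rootv i j $ k) = (if i \<in> A then 1 else 0) - (if j \<in> A then 1 else 0)"
  by (simp add: root_nth sum_subtractf)

text \<open>For a subspace \<open>L\<close> the reverse inclusion is automatic, so this says that
  \<open>L\<close> is the span of its roots.\<close>

definition root_spanned :: "(real ^ 'n) set \<Rightarrow> bool" where
  "root_spanned L \<longleftrightarrow> L \<subseteq> span {rootv i j | i j. rootv i j \<in> L}"

lemma subspace_root_sym: "subspace L \<Longrightarrow> rootv i j \<in> L \<Longrightarrow> rootv j i \<in> L"
  using subspace_neg[of L "rootv i j"] by (simp add: uminus_root)

lemma subspace_root_trans: "subspace L \<Longrightarrow> rootv i j \<in> L \<Longrightarrow> rootv j k \<in> L \<Longrightarrow> rootv i k \<in> L"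
  using subspace_add[of L "rootv i j" "rootv j k"] by (simp add: root_add)

lemma subspace_root_iff:
  assumes "subspace L" "rootv i j \<in> L"
  shows "rootv i k \<in> L \<longleftrightarrow> rootv j k \<in> L" "rootv k i \<in> L \<longleftrightarrow> rootv k j \<in> L"
  using subspace_root_sym[OF assms] subspace_root_trans[OF assms(1), of i j k]
    subspace_root_trans[OF assms(1), of j i k] subspace_root_trans[OF assms(1), of k i j]
    subspace_root_trans[OF assms(1), of k j i] assms(2) by blast+

lemma equiv_root:
  assumes "subspace L"
  shows "equiv X {(x, y). x \<in> X \<and> y \<in> X \<and> rootv x y \<in> L}"
  by (intro equivI refl_onI symI transI)
    (auto simp: subspace_0 assms intro: subspace_root_sym subspace_root_trans)

text \<open>A root in \<open>L\<close> has both or neither of its indices in a given class, so its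
  sum over the class vanishes; this linear condition passes to the span.\<close>

lemma root_spanned_class_sum:
  fixes L :: "(real ^ 'n) set"
  assumes L: "subspace L" "root_spanned L" and z: "z \<in> L"
  shows "(\<Sum>y | rootv x y \<in> L. z $ y) = 0"
proof -
  define S where "S = {z :: real ^ 'n. (\<Sum>y | rootv x y \<in> L. z $ y) = 0}"
  have "subspace S"
    unfolding S_def by (rule subspaceI) (auto simp: sum.distrib simp flip: sum_distrib_left)
  moreover have "{rootv i j | i j. rootv i j \<in> L} \<subseteq> S"
  proof clarify
    fix i j assume "rootv i j \<in> L"
    then have "rootv x i \<in> L \<longleftrightarrow> rootv x j \<in> L"
      by (rule subspace_root_iff[OF L(1)])
    then show "rootv i j \<in> S"
      by (simp add: S_def sum_root)
  qed
  ultimately have "span {rootv i j | i j. rootv i j \<in> L} \<subseteq> S"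
    by (rule span_minimal[rotated])
  then show ?thesis
    using L(2) z by (auto simp: root_spanned_def S_def)
qed

text \<open>Moving the whole mass of \<open>g\<close> in a class onto one representative uses only
  roots of \<open>L\<close>, and the vanishing class sums leave nothing there.\<close>

lemma class_sums_zero_imp_mem:
  fixes L :: "(real ^ 'n) set"
  assumes L: "subspace L" and g: "\<And>x. (\<Sum>y | rootv x y \<in> L. g $ y) = 0"
  shows "g \<in> L"
proof -
  \<comment> \<open>Equal classes give equal predicates, so the choice depends only on the class of
    \<open>v\<close>.\<close>
  define rep where "rep v = (SOME y. rootv v y \<in> L)" for v
  have rep: "rootv v (rep v) \<in> L" for v
    unfolding rep_def by (rule someI[of _ v]) (simp add: subspace_0 L)
  have rep_eq: "rep v = rep v'" if "rootv v v' \<in> L" for v v'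
  proof -
    have "(\<lambda>y. rootv v y \<in> L) = (\<lambda>y. rootv v' y \<in> L)"
      using subspace_root_iff(1)[OF L that] by blast
    then show ?thesis
      by (simp add: rep_def)
  qed
  have "(\<Sum>v | rep v = i. g $ v) = 0" for i
  proof (cases "\<exists>v0. rep v0 = i")
    case True
    then obtain v0 where v0: "rep v0 = i"
      by blast
    have "rep v = i \<longleftrightarrow> rootv v0 v \<in> L" for v
    proof
      assume "rep v = i"
      then have "rootv v i \<in> L" "rootv v0 i \<in> L"
        using rep[of v] rep[of v0] v0 by simp_all
      then show "rootv v0 v \<in> L"
        using subspace_root_iff(2)[OF L] by blast
    next
      assume "rootv v0 v \<in> L"
      then show "rep v = i"
        using rep_eq v0 by simp
    qed
    then have "{v. rep v = i} = {y. rootv v0 y \<in> L}"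
      by simp
    then show ?thesis
      using g[of v0] by simp
  qed simp
  moreover have "(\<Sum>v\<in>UNIV. g $ v *\<^sub>R axis (rep v) 1) $ i = (\<Sum>v | rep v = i. g $ v)" for i
    by (simp add: axis_def if_distrib[of "(*) _"] sum.If_cases eq_commute[of i "rep _"])
  ultimately have "(\<Sum>v\<in>UNIV. g $ v *\<^sub>R axis (rep v) 1) = (0 :: real ^ 'n)"
    by (simp add: vec_eq_iff)
  moreover have "(\<Sum>v\<in>UNIV. g $ v *\<^sub>R axis v 1) = g"
    by (simp add: vec_eq_iff axis_def if_distrib[of "(*) _"] cong: if_cong)
  ultimately have "g = (\<Sum>v\<in>UNIV. g $ v *\<^sub>R rootv v (rep v))"
    by (simp add: rootv_def scaleR_diff_right sum_subtractf)
  also have "\<dots> \<in> L"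
    by (intro subspace_sum subspace_scale L rep)
  finally show ?thesis .
qed

section \<open>Partitions of the coordinates and a common root\<close>

lemma card_quotient_le:
  assumes X: "finite X" and r: "equiv X r"
    and two: "\<And>x. x \<in> X \<Longrightarrow> \<exists>y. (x, y) \<in> r \<and> y \<noteq> x"
  shows "2 * card (X // r) \<le> card X"
proof -
  have fin: "finite C" if "C \<in> X // r" for C
    using that Union_quotient[OF r] X by (metis Union_upper finite_subset)
  have "2 \<le> card C" if C: "C \<in> X // r" for C
  proof -
    obtain x where x: "x \<in> X" "C = r `` {x}"
      using C by (auto elim: quotientE)
    obtain y where y: "(x, y) \<in> r" "y \<noteq> x"
      using two x by blast
    have "{x, y} \<subseteq> C"
      using x y equiv_class_self[OF r x(1)] by auto
    then have "card {x, y} \<le> card C"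
      using fin[OF C] card_mono by blast
    then show ?thesis
      using y by simp
  qed
  then have "card (X // r) * 2 \<le> (\<Sum>C\<in>X // r. card C)"
    using sum_mono[of "X // r" "\<lambda>_. 2" card] by simp
  also have "\<dots> = card (\<Union> (X // r))"
    using fin quotient_disj[OF r] by (intro card_Union_disjoint[symmetric]) (auto simp: pairwise_def disjnt_def)
  also have "\<dots> = card X"
    by (simp add: Union_quotient r)
  finally show ?thesis
    by simp
qed

text \<open>A dimension count: each relation has at most \<open>card X / 2\<close> classes, so
  together with vanishing off \<open>X\<close> there are at most \<open>CARD('n)\<close> linear
  conditions. One is redundant, since the class sums of either relation add up to the sum over
  \<open>X\<close>; hence a nonzero solution exists.\<close>

lemma nonzero_with_class_sums_zero:
  fixes X :: "'n::finite set"
  assumes r: "equiv X r" and s: "equiv X s" and ne: "X \<noteq> {}"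
    and two_r: "\<And>x. x \<in> X \<Longrightarrow> \<exists>y. (x, y) \<in> r \<and> y \<noteq> x"
    and two_s: "\<And>x. x \<in> X \<Longrightarrow> \<exists>y. (x, y) \<in> s \<and> y \<noteq> x"
  obtains g :: "real ^ 'n" where "g \<noteq> 0" "\<And>v. v \<notin> X \<Longrightarrow> g $ v = 0"
    "\<And>C. C \<in> X // r \<union> X // s \<Longrightarrow> (\<Sum>v\<in>C. g $ v) = 0"
proof -
  define ind where "ind C = (\<chi> i. if i \<in> C then 1 else (0 :: real))" for C :: "'n set"
  have inner_ind: "z \<bullet> ind C = (\<Sum>v\<in>C. z $ v)" for z C
    by (simp add: inner_vec_def ind_def if_distrib sum.If_cases cong: if_cong)
  obtain C0 where C0: "C0 \<in> X // s"
    using ne by (meson ex_in_conv quotientI)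
  \<comment> \<open>The condition for \<open>C0\<close> is left out to make the count strict; it is
    recovered below from the others.\<close>
  define V where "V = ind ` (X // r) \<union> ind ` (X // s - {C0}) \<union> (\<lambda>v. axis v 1) ` (- X)"
  have "card V \<le> card (X // r) + card (X // s - {C0}) + card (- X)"
    unfolding V_def
    by (intro order_trans[OF card_Un_le] add_mono card_image_le) auto
  also have "\<dots> < card (X // r) + card (X // s) + card (- X)"
    using card_Diff1_less[OF _ C0] by simp
  also have "\<dots> \<le> card X + card (- X)"
    using card_quotient_le[OF _ r two_r] card_quotient_le[OF _ s two_s] by simp
  also have "\<dots> = CARD('n)"
    using card_Un_disjoint[of X "- X"] by simp
  finally have "dim V < DIM(real ^ 'n)"
    using dim_le_card'[of V] by (simp add: V_def)
  then obtain g :: "real ^ 'n" where g: "g \<noteq> 0" "\<And>y. y \<in> span V \<Longrightarrow> orthogonal g y"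
    using orthogonal_to_subspace_exists by blast
  have gV: "g \<bullet> y = 0" if "y \<in> V" for y
    using g(2) span_base[OF that] by (simp add: orthogonal_def)
  have sum_quotient: "(\<Sum>v\<in>X. g $ v) = (\<Sum>C\<in>X // t. \<Sum>v\<in>C. g $ v)" if "equiv X t" for t
    using sum.Union_disjoint[of "X // t" "\<lambda>v. g $ v"] quotient_disj[OF that]
    by (auto simp: Union_quotient[OF that])
  have r0: "(\<Sum>v\<in>C. g $ v) = 0" if "C \<in> X // r" for C
    using gV[of "ind C"] that by (simp add: V_def inner_ind)
  have s0: "(\<Sum>v\<in>C. g $ v) = 0" if "C \<in> X // s - {C0}" for C
    using gV[of "ind C"] that by (simp add: V_def inner_ind)
  have "0 = (\<Sum>C\<in>X // s. \<Sum>v\<in>C. g $ v)"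
    using sum_quotient[OF r] sum_quotient[OF s] r0 by simp
  also have "\<dots> = (\<Sum>v\<in>C0. g $ v)"
    using s0 by (simp add: sum.remove[OF _ C0])
  finally have "(\<Sum>v\<in>C0. g $ v) = 0" by simp
  with r0 s0 have "(\<Sum>v\<in>C. g $ v) = 0" if "C \<in> X // r \<union> X // s" for C
    using that by blast
  moreover have "g $ v = 0" if "v \<notin> X" for v
    using gV[of "axis v 1"] that by (simp add: V_def inner_axis)
  ultimately show ?thesis
    using that g(1) by blast
qed

text \<open>
  If no root were common, then on the support of \<open>w\<close> within one class of \<open>L1\<close> the classes of \<open>L2\<close> and
  of \<open>L3\<close> would all have at least two elements, but meet in single points. Counting classes yields a
  nonzero \<open>g \<in> L2 \<inter> L3\<close> there, while every element of \<open>L2 \<inter> L3\<close> has sum zero over the common classes.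
\<close>

lemma common_root:
  fixes L1 L2 L3 :: "(real ^ 'n) set"
  assumes L: "subspace L1" "subspace L2" "subspace L3"
    and spanned: "root_spanned (L1 \<inter> L2)" "root_spanned (L1 \<inter> L3)" "root_spanned (L2 \<inter> L3)"
    and w: "w \<in> L1 \<inter> L2 \<inter> L3" "w \<noteq> 0"
  obtains i j where "i \<noteq> j" "rootv i j \<in> L1 \<inter> L2 \<inter> L3"
proof (rule ccontr)
  assume "\<not> thesis"
  then have no_root: "i = j" if "rootv i j \<in> L1 \<inter> L2 \<inter> L3" for i j
    using that \<open>\<And>j i. i \<noteq> j \<Longrightarrow> rootv i j \<in> L1 \<inter> L2 \<inter> L3 \<Longrightarrow> thesis\<close> by metis
  obtain v where v: "w $ v \<noteq> 0"
    using w(2) by (auto simp: vec_eq_iff)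
  define X where "X = {x. rootv v x \<in> L1 \<and> w $ x \<noteq> 0}"
  have "v \<in> X"
    using v by (simp add: X_def subspace_0 L)
  \<comment> \<open>Without such a \<open>y\<close>, the point \<open>x\<close> would be alone in
    its \<open>L1 \<inter> M\<close> class within the support of \<open>w\<close>, and the class sum
    of \<open>w\<close> would be \<open>w $ x\<close>.\<close>
  have neighbour: "\<exists>y. y \<in> X \<and> rootv x y \<in> M \<and> y \<noteq> x"
    if M: "subspace M" "root_spanned (L1 \<inter> M)" "w \<in> M" and x: "x \<in> X" for x M
  proof (rule ccontr)
    assume contra: "\<nexists>y. y \<in> X \<and> rootv x y \<in> M \<and> y \<noteq> x"
    have x': "rootv v x \<in> L1" "w $ x \<noteq> 0"
      using x by (auto simp: X_def)
    have "w $ y = 0" if "rootv x y \<in> L1 \<inter> M" "y \<noteq> x" for y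
      using that contra subspace_root_trans[OF L(1) x'(1)] by (auto simp: X_def)
    then have "(\<Sum>y | rootv x y \<in> L1 \<inter> M. w $ y) = (\<Sum>y\<in>{x}. w $ y)"
      by (intro sum.mono_neutral_right) (auto simp: subspace_0 L M)
    with root_spanned_class_sum[of "L1 \<inter> M" w x] M w L x' show False
      by (simp add: subspace_inter)
  qed
  define r where "r M = {(x, y). x \<in> X \<and> y \<in> X \<and> rootv x y \<in> M}" for M
  have "equiv X (r L2)" "equiv X (r L3)"
    using equiv_root L unfolding r_def by auto
  moreover have "\<exists>y. (x, y) \<in> r L2 \<and> y \<noteq> x" "\<exists>y. (x, y) \<in> r L3 \<and> y \<noteq> x" if "x \<in> X" for x
    using neighbour[of L2 x] neighbour[of L3 x] that L spanned w unfolding r_def by auto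
  ultimately obtain g :: "real ^ 'n" where g: "g \<noteq> 0" "\<And>v. v \<notin> X \<Longrightarrow> g $ v = 0"
    "\<And>C. C \<in> X // r L2 \<union> X // r L3 \<Longrightarrow> (\<Sum>v\<in>C. g $ v) = 0"
    using nonzero_with_class_sums_zero[of X "r L2" "r L3"] \<open>v \<in> X\<close> by blast
  \<comment> \<open>A class of \<open>M\<close> on all coordinates meets \<open>X\<close> in a class
    of \<open>r M\<close> or not at all, and \<open>g\<close> vanishes off \<open>X\<close>.\<close>
  have "g \<in> M" if M: "subspace M" "\<And>C. C \<in> X // r M \<Longrightarrow> (\<Sum>v\<in>C. g $ v) = 0" for M
  proof (rule class_sums_zero_imp_mem[OF M(1)])
    fix x
    have eq: "(\<Sum>y | rootv x y \<in> M. g $ y) = (\<Sum>y\<in>{y \<in> X. rootv x y \<in> M}. g $ y)"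
      using g(2) by (intro sum.mono_neutral_right) auto
    show "(\<Sum>y | rootv x y \<in> M. g $ y) = 0"
    proof (cases "\<exists>x'\<in>X. rootv x x' \<in> M")
      case True
      then obtain x' where x': "x' \<in> X" "rootv x x' \<in> M" by blast
      then have "{y \<in> X. rootv x y \<in> M} = r M `` {x'}"
        using subspace_root_iff(1)[OF M(1) x'(2)] unfolding r_def by auto
      then show ?thesis
        using M(2)[of "r M `` {x'}"] x' eq by (simp add: quotientI)
    next
      case False
      then have "{y \<in> X. rootv x y \<in> M} = {}" by blast
      with eq show ?thesis by simp
    qed
  qed
  then have g23: "g \<in> L2 \<inter> L3"
    using g(3) L by blast
  \<comment> \<open>Other points of the \<open>L2 \<inter> L3\<close> class of \<open>x\<close>
    carry no mass: one in \<open>X\<close> would share the \<open>L1\<close> class of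
    \<open>x\<close> and give a common root. So the class sum is \<open>g $ x\<close>.\<close>
  have "g $ x = 0" if "x \<in> X" for x
  proof -
    have "g $ y = 0" if "rootv x y \<in> L2 \<inter> L3" "y \<noteq> x" for y
    proof (rule ccontr)
      assume "g $ y \<noteq> 0"
      then have "rootv v y \<in> L1" "rootv v x \<in> L1"
        using g(2)[of y] \<open>x \<in> X\<close> unfolding X_def by blast+
      then have "rootv x y \<in> L1"
        using subspace_root_iff(1)[OF L(1)] by blast
      with no_root[of x y] that show False by blast
    qed
    then have "(\<Sum>y | rootv x y \<in> L2 \<inter> L3. g $ y) = (\<Sum>y\<in>{x}. g $ y)"
      by (intro sum.mono_neutral_right) (auto simp: subspace_0 L)
    with root_spanned_class_sum[OF _ spanned(3) g23, of x] show ?thesis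
      by (simp add: subspace_inter L)
  qed
  with g(1,2) show False
    by (metis vec_eq_iff zero_index)
qed

section \<open>Faces maximising a linear functional\<close>

text \<open>Read for fixed \<open>x\<close> and varying \<open>w\<close>, membership of
  \<open>x\<close> says that \<open>w\<close> lies in the normal cone of \<open>Q\<close> at
  \<open>x\<close>; both readings are used.\<close>

definition face_max :: "'a::real_inner set \<Rightarrow> 'a \<Rightarrow> 'a set" where
  "face_max Q w = {x \<in> Q. \<forall>y\<in>Q. w \<bullet> y \<le> w \<bullet> x}"

lemma face_max_nonempty:
  assumes "compact Q" "Q \<noteq> {}"
  shows "face_max Q w \<noteq> {}"
proof -
  have "continuous_on Q (\<lambda>y. w \<bullet> y)"
    by (intro continuous_intros)
  then obtain x where "x \<in> Q" "\<forall>y\<in>Q. w \<bullet> y \<le> w \<bullet> x"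
    using continuous_attains_sup assms by blast
  then show ?thesis
    by (auto simp: face_max_def)
qed

lemma convex_face_max:
  assumes "convex Q"
  shows "convex (face_max Q w)"
proof (cases "face_max Q w = {}")
  case False
  then obtain x where x: "x \<in> Q" "\<forall>y\<in>Q. w \<bullet> y \<le> w \<bullet> x"
    by (auto simp: face_max_def)
  then have "face_max Q w = Q \<inter> {y. w \<bullet> y = w \<bullet> x}"
    by (force simp: face_max_def)
  then show ?thesis
    by (simp add: assms convex_Int convex_hyperplane)
qed simp

lemma inner_face_max_eq: "x \<in> face_max Q w \<Longrightarrow> y \<in> face_max Q w \<Longrightarrow> w \<bullet> x = w \<bullet> y"
  by (intro antisym) (auto simp: face_max_def)

lemma face_max_scale: "c > 0 \<Longrightarrow> face_max Q (c *\<^sub>R w) = face_max Q w"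
  by (simp add: face_max_def)

text \<open>A sum \<open>x + y\<close> is maximal exactly when neither summand can be improved while
  the other is fixed.\<close>

lemma face_max_plus: "face_max (P + Q) w = face_max P w + face_max Q w"
proof (intro equalityI subsetI)
  fix z assume z: "z \<in> face_max (P + Q) w"
  then obtain x y where xy: "z = x + y" "x \<in> P" "y \<in> Q"
    by (auto simp: face_max_def elim: set_plus_elim)
  have *: "w \<bullet> (x' + y') \<le> w \<bullet> (x + y)" if "x' \<in> P" "y' \<in> Q" for x' y'
    using z xy that by (auto simp: face_max_def)
  have "x \<in> face_max P w" "y \<in> face_max Q w"
    using xy *[OF _ xy(3)] *[OF xy(2)] by (auto simp: face_max_def inner_add_right)
  then show "z \<in> face_max P w + face_max Q w"
    using xy by blast
next
  fix z assume "z \<in> face_max P w + face_max Q w"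
  then show "z \<in> face_max (P + Q) w"
    by (auto simp: face_max_def inner_add_right intro!: add_mono elim!: set_plus_elim)
qed

text \<open>It suffices to compare \<open>x\<close> with finitely many generators: those on the face
  stay tied with \<open>x\<close>, the others lose strictly at \<open>s = 0\<close> and hence for
  small \<open>s\<close> of either sign.\<close>

lemma eventually_face_max_perturb:
  assumes Q: "polytope Q" and x: "x \<in> face_max Q w"
    and z: "\<And>y. y \<in> face_max Q w \<Longrightarrow> z \<bullet> y = z \<bullet> x"
  shows "\<forall>\<^sub>F s in nhds (0::real). x \<in> face_max Q (w + s *\<^sub>R z)"
proof -
  obtain V where V: "finite V" "Q = convex hull V"
    using Q by (auto simp: polytope_def)
  have "\<forall>\<^sub>F s in nhds (0::real). (w + s *\<^sub>R z) \<bullet> v \<le> (w + s *\<^sub>R z) \<bullet> x" if "v \<in> V" for v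
  proof -
    have vQ: "v \<in> Q"
      using V that by (simp add: hull_inc)
    show ?thesis
    proof (cases "v \<in> face_max Q w")
      case True
      then show ?thesis
        using z[OF True] inner_face_max_eq[OF True x] by (simp add: inner_add_left)
    next
      case False
      then have "w \<bullet> v < w \<bullet> x"
        using x vQ by (force simp: face_max_def)
      moreover have "((\<lambda>s. (w + s *\<^sub>R z) \<bullet> x - (w + s *\<^sub>R z) \<bullet> v) \<longlongrightarrow>
          (w + 0 *\<^sub>R z) \<bullet> x - (w + 0 *\<^sub>R z) \<bullet> v) (nhds (0::real))"
        by (intro tendsto_intros filterlim_ident)
      ultimately have "\<forall>\<^sub>F s in nhds (0::real). (w + s *\<^sub>R z) \<bullet> x - (w + s *\<^sub>R z) \<bullet> v > 0"
        by (intro order_tendstoD(1)) auto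
      then show ?thesis
        by eventually_elim simp
    qed
  qed
  then have "\<forall>\<^sub>F s in nhds (0::real). \<forall>v\<in>V. (w + s *\<^sub>R z) \<bullet> v \<le> (w + s *\<^sub>R z) \<bullet> x"
    using V(1) by (simp add: eventually_ball_finite)
  then show ?thesis
  proof eventually_elim
    case (elim s)
    have "Q \<subseteq> {y. (w + s *\<^sub>R z) \<bullet> y \<le> (w + s *\<^sub>R z) \<bullet> x}"
      unfolding V(2) using elim by (intro hull_minimal convex_halfspace_le) auto
    then show ?case
      using x by (auto simp: face_max_def)
  qed
qed

section \<open>Directions constant on a face and their span by roots\<close>

text \<open>
  If \<open>w\<close> has sum zero, this is the span of the vectors \<open>z\<close> that lie, for every \<open>x\<close> in the face maximising
  \<open>w\<close>, in the normal cone at \<open>x\<close>, have sum zero, and are positive or negative only where \<open>w\<close> is.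
\<close>

definition const_dirs :: "(real ^ 'n) set \<Rightarrow> real ^ 'n \<Rightarrow> (real ^ 'n) set" where
  "const_dirs Q w = {z \<in> sum_zero_hyperplane. (\<forall>v. w $ v = 0 \<longrightarrow> z $ v = 0) \<and>
     (\<forall>x\<in>face_max Q w. \<forall>y\<in>face_max Q w. z \<bullet> (x - y) = 0)}"

lemma subspace_const_dirs: "subspace (const_dirs Q w)"
  unfolding const_dirs_def sum_zero_hyperplane_def
  by (rule subspaceI) (simp_all add: inner_add_left sum.distrib flip: sum_distrib_left)

lemma const_dirs_inner_eq:
  assumes "z \<in> const_dirs Q w" "x \<in> face_max Q w" "y \<in> face_max Q w"
  shows "z \<bullet> x = z \<bullet> y"
proof -
  have "z \<bullet> (x - y) = 0"
    using assms unfolding const_dirs_def by blast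
  then show ?thesis
    by (simp add: inner_diff_right)
qed

lemma self_in_const_dirs: "w \<in> sum_zero_hyperplane \<Longrightarrow> w \<in> const_dirs Q w"
  unfolding const_dirs_def by (simp add: inner_diff_right) (blast intro: inner_face_max_eq)

text \<open>The face of the sum is the sum of the faces; fixing a point of one face and varying the
  other separates the two constancy conditions.\<close>

lemma const_dirs_plus:
  assumes "compact P" "P \<noteq> {}" "compact Q" "Q \<noteq> {}"
  shows "const_dirs (P + Q) w = const_dirs P w \<inter> const_dirs Q w"
proof -
  obtain p q where pq: "p \<in> face_max P w" "q \<in> face_max Q w"
    using assms face_max_nonempty by (metis ex_in_conv)
  have "(\<forall>x\<in>face_max (P + Q) w. \<forall>y\<in>face_max (P + Q) w. z \<bullet> (x - y) = 0) \<longleftrightarrow>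
      (\<forall>x\<in>face_max P w. \<forall>y\<in>face_max P w. z \<bullet> (x - y) = 0) \<and>
      (\<forall>x\<in>face_max Q w. \<forall>y\<in>face_max Q w. z \<bullet> (x - y) = 0)" (is "?l \<longleftrightarrow> ?r") for z
  proof
    assume l: ?l
    have "z \<bullet> ((x + y) - (x' + y')) = 0"
      if "x \<in> face_max P w" "y \<in> face_max Q w" "x' \<in> face_max P w" "y' \<in> face_max Q w" for x y x' y'
      using l that unfolding face_max_plus by blast
    from this[OF _ pq(2) _ pq(2)] this[OF pq(1) _ pq(1)] show ?r
      by simp
  next
    assume r: ?r
    show ?l
    proof (intro ballI)
      fix s t assume "s \<in> face_max (P + Q) w" "t \<in> face_max (P + Q) w"
      then obtain x y x' y' where "s = x + y" "t = x' + y'"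
        "x \<in> face_max P w" "y \<in> face_max Q w" "x' \<in> face_max P w" "y' \<in> face_max Q w"
        unfolding face_max_plus by (meson set_plus_elim)
      with r have "z \<bullet> (x - x') + z \<bullet> (y - y') = 0"
        by simp
      with \<open>s = x + y\<close> \<open>t = x' + y'\<close> show "z \<bullet> (s - t) = 0"
        by (simp add: inner_add_right inner_diff_right)
    qed
  qed
  then show ?thesis
    unfolding const_dirs_def by blast
qed

lemma polytope_plus:
  assumes "polytope P" "polytope Q"
  shows "polytope (P + Q)"
proof -
  obtain V W where "finite V" "P = convex hull V" "finite W" "Q = convex hull W"
    using assms by (auto simp: polytope_def)
  then have "finite (V + W)" "P + Q = convex hull (V + W)"
    by (simp_all add: finite_set_plus convex_hull_set_plus)
  then show ?thesis
    unfolding polytope_def by blast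
qed

lemma alcoved_imp_polytope: "alcoved Q \<Longrightarrow> polytope Q"
  by (simp add: alcoved_def)

text \<open>Zero coordinates of \<open>w\<close> do not move, and the others keep their sign under
  small perturbations.\<close>

lemma eventually_same_sign:
  fixes w z :: "real ^ 'n"
  assumes "\<And>v. w $ v = 0 \<Longrightarrow> z $ v = 0"
  shows "\<forall>\<^sub>F s in nhds (0::real). \<forall>v. sgn ((w + s *\<^sub>R z) $ v) = sgn (w $ v)"
proof -
  have "\<forall>\<^sub>F s in nhds (0::real). sgn ((w + s *\<^sub>R z) $ v) = sgn (w $ v)" for v
  proof -
    have lim: "((\<lambda>s. w $ v + s * z $ v) \<longlongrightarrow> w $ v + 0 * z $ v) (nhds (0::real))"
      by (intro tendsto_intros filterlim_ident)
    consider "w $ v = 0" | "w $ v > 0" | "w $ v < 0"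
      by linarith
    then show ?thesis
    proof cases
      case 1
      with assms show ?thesis by simp
    next
      case 2
      then have "\<forall>\<^sub>F s in nhds (0::real). w $ v + s * z $ v > 0"
        using lim by (intro order_tendstoD(1)) auto
      then show ?thesis
        by eventually_elim (use 2 in simp)
    next
      case 3
      then have "\<forall>\<^sub>F s in nhds (0::real). w $ v + s * z $ v < 0"
        using lim by (intro order_tendstoD(2)) auto
      then show ?thesis
        by eventually_elim (use 3 in simp)
    qed
  qed
  then show ?thesis
    by (simp add: eventually_all_finite)
qed

text \<open>By orthogonal decomposition it suffices that each \<open>y\<close> orthogonal to the
  roots in \<open>const_dirs Q w\<close> is orthogonal to the whole space. To see this, a relative
  interior point of the face is moved inside \<open>Q\<close> along a potential built from
  \<open>y\<close>, which cannot increase any functional maximised at that point.\<close>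

lemma alcoved_root_spanned:
  fixes Q :: "(real ^ 'n) set"
  assumes Q: "alcoved Q" "Q \<noteq> {}" and w: "w \<in> sum_zero_hyperplane"
  shows "root_spanned (const_dirs Q w)"
proof -
  define L where "L = const_dirs Q w"
  define R where "R = {rootv i j | i j. rootv i j \<in> L}"
  have poly: "polytope Q" and QH: "Q \<subseteq> sum_zero_hyperplane"
    using Q by (auto simp: alcoved_def)
  obtain a where a: "Q = {x \<in> sum_zero_hyperplane. \<forall>i j. i \<noteq> j \<longrightarrow> x $ i - x $ j \<le> a i j}"
    using Q by (auto simp: alcoved_def)
  have cF: "convex (face_max Q w)"
    by (simp add: convex_face_max poly polytope_imp_convex)
  have "face_max Q w \<noteq> {}"
    by (simp add: face_max_nonempty poly polytope_imp_compact Q)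
  then obtain x where xr: "x \<in> rel_interior (face_max Q w)"
    using rel_interior_eq_empty[OF cF] by blast
  then have xF: "x \<in> face_max Q w"
    using rel_interior_subset by blast
  then have xQ: "x \<in> Q"
    by (simp add: face_max_def)
  \<comment> \<open>Tightness is measured against the maximum over \<open>Q\<close>, since the bound
    \<open>a i j\<close> need not be attained; this makes \<open>T\<close> transitive.\<close>
  define T where "T i j \<longleftrightarrow> x \<in> face_max Q (rootv i j)" for i j
  have T_refl: "T i i" for i
    by (simp add: T_def face_max_def xQ)
  have T_trans: "T i k" if "T i j" "T j k" for i j k
    using that unfolding T_def face_max_def
    by (simp add: inner_root) (smt (verit))
  have T_root: "rootv i j \<in> L" if "T i j" "w $ i > 0" "w $ j < 0" for i j
  proof -
    have "rootv i j \<bullet> y = rootv i j \<bullet> x" if y: "y \<in> face_max Q w" for y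
    proof (rule antisym)
      show "rootv i j \<bullet> y \<le> rootv i j \<bullet> x"
        using \<open>T i j\<close> y by (simp add: T_def face_max_def)
      \<comment> \<open>As \<open>x\<close> is relatively interior, the segment from
        \<open>y\<close> can be prolonged beyond \<open>x\<close> within the face; maximality of
        \<open>x\<close> at the far end gives the reverse inequality at \<open>y\<close>.\<close>
      obtain e where e: "e > 1" "(1 - e) *\<^sub>R y + e *\<^sub>R x \<in> face_max Q w"
        using convex_rel_interior_if[OF cF xr] hull_inc[OF y, of affine] by (metis order_refl)
      then have "rootv i j \<bullet> ((1 - e) *\<^sub>R y + e *\<^sub>R x) \<le> rootv i j \<bullet> x"
        using \<open>T i j\<close> by (simp add: T_def face_max_def)
      then have "(e - 1) * (rootv i j \<bullet> x - rootv i j \<bullet> y) \<le> 0"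
        by (simp add: inner_add_right algebra_simps)
      with e(1) show "rootv i j \<bullet> x \<le> rootv i j \<bullet> y"
        by (simp add: mult_le_0_iff)
    qed
    moreover have "rootv i j $ v = 0" if "w $ v = 0" for v
      using that \<open>w $ i > 0\<close> \<open>w $ j < 0\<close> by (auto simp: root_nth)
    moreover have "rootv i j \<in> sum_zero_hyperplane"
      by (simp add: sum_zero_hyperplane_def sum_root)
    ultimately show ?thesis
      unfolding L_def const_dirs_def by (simp add: inner_diff_right)
  qed
  \<comment> \<open>The potential \<open>y\<close> is replaced by the least one above it on the positive part of \<open>w\<close> that is
    monotone along the tight roots at \<open>x\<close>; moving \<open>x\<close> along it stays inside \<open>Q\<close>.\<close>
  have key: "y \<bullet> z \<le> 0"
    if y: "\<And>r. r \<in> R \<Longrightarrow> y \<bullet> r = 0" and xz: "x \<in> face_max Q z"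
      and sgn: "\<And>v. sgn (z $ v) = sgn (w $ v)" and zH: "z \<in> sum_zero_hyperplane" for y z
  proof -
    define m where "m = Min (range (($) y))"
    \<comment> \<open>The value \<open>m\<close>, a lower bound of all coordinates of
      \<open>y\<close>, is the default when no positive \<open>i\<close> satisfies
      \<open>T i k\<close>.\<close>
    define Y where "Y k = Max (insert m (($) y ` {i. w $ i > 0 \<and> T i k}))" for k
    \<comment> \<open>Centering keeps the motion in the hyperplane and does not change the pairing
      with \<open>z\<close>, which has sum zero.\<close>
    define c where "c = (\<Sum>k\<in>UNIV. Y k) / real CARD('n)"
    define d where "d = (\<chi> k. Y k - c)"
    have Y_mono: "Y k \<le> Y l" if "T k l" for k l
      unfolding Y_def by (intro Max_mono) (use that T_trans in auto)
    have Y_pos: "y $ i \<le> Y i" if "w $ i > 0" for i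
      unfolding Y_def by (intro Max_ge) (use that T_refl in auto)
    \<comment> \<open>A tight root from the positive to the negative part of \<open>w\<close> lies
      in \<open>R\<close>, so \<open>y\<close> takes equal values at its two ends.\<close>
    have Y_neg: "Y j \<le> y $ j" if "w $ j < 0" for j
    proof -
      have "y $ i = y $ j" if "w $ i > 0" "T i j" for i
        using y[of "rootv i j"] T_root[OF that(2,1) \<open>w $ j < 0\<close>]
        by (auto simp: R_def inner_root inner_commute[of y])
      moreover have "m \<le> y $ j"
        unfolding m_def by (intro Min_le) auto
      ultimately show ?thesis
        unfolding Y_def by (subst Max_le_iff) auto
    qed
    have dH: "(\<Sum>k\<in>UNIV. d $ k) = 0"
      by (simp add: d_def c_def sum_subtractf)
    \<comment> \<open>Bounds attained at \<open>x\<close> are preserved by monotonicity of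
      \<open>Y\<close> along \<open>T\<close>; the others have slack for small
      \<open>e\<close>.\<close>
    have "\<forall>\<^sub>F e in at_right 0. i \<noteq> j \<longrightarrow> (x + e *\<^sub>R d) $ i - (x + e *\<^sub>R d) $ j \<le> a i j" for i j
    proof (cases "i = j \<or> x $ i - x $ j = a i j")
      case True
      show ?thesis
      proof (cases "i = j")
        case False
        then have tight: "x $ i - x $ j = a i j"
          using True by simp
        have "T i j"
          unfolding T_def face_max_def using xQ tight False by (auto simp: inner_root a)
        then have "d $ i \<le> d $ j"
          using Y_mono by (simp add: d_def)
        have "\<forall>\<^sub>F e::real in at_right 0. e > 0"
          by (simp add: eventually_at_right_less)
        then show ?thesis
        proof eventually_elim
          case (elim e)
          then have "e * d $ i \<le> e * d $ j"
            using \<open>d $ i \<le> d $ j\<close> by (simp add: mult_left_mono)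
          then show ?case
            using tight by simp
        qed
      qed simp
    next
      case False
      then have "x $ i - x $ j < a i j"
        using xQ a by force
      moreover have "((\<lambda>e. (x + e *\<^sub>R d) $ i - (x + e *\<^sub>R d) $ j) \<longlongrightarrow>
          (x + 0 *\<^sub>R d) $ i - (x + 0 *\<^sub>R d) $ j) (at_right (0::real))"
        by (intro tendsto_intros)
      ultimately have "\<forall>\<^sub>F e in at_right (0::real). (x + e *\<^sub>R d) $ i - (x + e *\<^sub>R d) $ j < a i j"
        by (intro order_tendstoD(2)) auto
      then show ?thesis
        by eventually_elim simp
    qed
    then have "\<forall>\<^sub>F e in at_right (0::real). \<forall>i j. i \<noteq> j \<longrightarrow> (x + e *\<^sub>R d) $ i - (x + e *\<^sub>R d) $ j \<le> a i j"
      by (intro eventually_all_finite)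
    moreover have "\<forall>\<^sub>F e::real in at_right 0. e > 0"
      by (simp add: eventually_at_right_less)
    ultimately have "\<forall>\<^sub>F e in at_right (0::real). e > 0 \<and>
        (\<forall>i j. i \<noteq> j \<longrightarrow> (x + e *\<^sub>R d) $ i - (x + e *\<^sub>R d) $ j \<le> a i j)"
      by eventually_elim blast
    from eventually_happens'[OF trivial_limit_at_right_real this] obtain e :: real where e: "e > 0"
      "\<forall>i j. i \<noteq> j \<longrightarrow> (x + e *\<^sub>R d) $ i - (x + e *\<^sub>R d) $ j \<le> a i j"
      by blast
    have "x + e *\<^sub>R d \<in> sum_zero_hyperplane"
      using xQ QH dH by (auto simp: sum_zero_hyperplane_def sum.distrib simp flip: sum_distrib_left)
    with e(2) have "x + e *\<^sub>R d \<in> Q"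
      unfolding a by blast
    then have "z \<bullet> (x + e *\<^sub>R d) \<le> z \<bullet> x"
      using xz by (simp add: face_max_def)
    then have zd: "z \<bullet> d \<le> 0"
      using e(1) by (simp add: inner_add_right mult_le_0_iff)
    have "y \<bullet> z = (\<Sum>k\<in>UNIV. z $ k * y $ k)"
      by (simp add: inner_vec_def mult.commute)
    also have "\<dots> \<le> (\<Sum>k\<in>UNIV. z $ k * Y k)"
    proof (rule sum_mono)
      fix k
      consider "w $ k = 0" | "w $ k > 0" | "w $ k < 0"
        by linarith
      then show "z $ k * y $ k \<le> z $ k * Y k"
      proof cases
        case 1
        then show ?thesis using sgn[of k] by (simp add: sgn_0_0)
      next
        case 2
        then have "z $ k > 0" using sgn[of k] by (simp add: sgn_1_pos)
        then show ?thesis using Y_pos[OF 2] by simp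
      next
        case 3
        then have "z $ k < 0" using sgn[of k] by (simp add: sgn_1_neg)
        then show ?thesis using Y_neg[OF 3] by simp
      qed
    qed
    also have "\<dots> = z \<bullet> d"
      using zH by (simp add: inner_vec_def d_def right_diff_distrib sum_subtractf sum_zero_hyperplane_def
          flip: sum_distrib_right)
    finally show ?thesis
      using zd by simp
  qed
  have orth: "y \<bullet> z = 0" if y: "\<And>r. r \<in> R \<Longrightarrow> y \<bullet> r = 0" and z: "z \<in> L" for y z
  proof -
    have "\<forall>\<^sub>F s in nhds (0::real). x \<in> face_max Q (w + s *\<^sub>R z)"
      using z xF by (intro eventually_face_max_perturb poly) (auto simp: L_def intro: const_dirs_inner_eq)
    moreover have "\<forall>\<^sub>F s in nhds (0::real). \<forall>v. sgn ((w + s *\<^sub>R z) $ v) = sgn (w $ v)"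
      using z by (intro eventually_same_sign) (auto simp: L_def const_dirs_def)
    ultimately have ev: "\<forall>\<^sub>F s in nhds (0::real). x \<in> face_max Q (w + s *\<^sub>R z) \<and>
        (\<forall>v. sgn ((w + s *\<^sub>R z) $ v) = sgn (w $ v))"
      by (rule eventually_conj)
    then have "\<forall>\<^sub>F s in at_right (0::real). x \<in> face_max Q (w + s *\<^sub>R z) \<and>
        (\<forall>v. sgn ((w + s *\<^sub>R z) $ v) = sgn (w $ v))"
      by (simp add: eventually_nhds_conv_at eventually_at_split)
    moreover have "\<forall>\<^sub>F e::real in at_right 0. e > 0"
      by (simp add: eventually_at_right_less)
    ultimately have "\<forall>\<^sub>F s in at_right (0::real). s > 0 \<and> x \<in> face_max Q (w + s *\<^sub>R z) \<and>
        (\<forall>v. sgn ((w + s *\<^sub>R z) $ v) = sgn (w $ v))"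
      by eventually_elim blast
    from eventually_happens'[OF trivial_limit_at_right_real this] obtain s :: real where s: "s > 0"
        "x \<in> face_max Q (w + s *\<^sub>R z)"
        "\<And>v. sgn ((w + s *\<^sub>R z) $ v) = sgn (w $ v)"
      by blast
    have zH: "w + s *\<^sub>R z \<in> sum_zero_hyperplane"
      using w z by (auto simp: L_def const_dirs_def sum_zero_hyperplane_def sum.distrib simp flip: sum_distrib_left)
    have "- y \<bullet> r = 0" if "r \<in> R" for r
      using y that by simp
    \<comment> \<open>Using \<open>key\<close> for both \<open>y\<close> and \<open>- y\<close>
      turns the inequality into an equality, at \<open>w\<close> and at its perturbation; their
      difference is \<open>s\<close> times the claim.\<close>
    with y key[of y, OF _ s(2,3) zH] key[of "- y", OF _ s(2,3) zH] key[of y w] key[of "- y" w] xF w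
    have "y \<bullet> (w + s *\<^sub>R z) = 0" "y \<bullet> w = 0"
      by force+
    then show ?thesis
      using s(1) by (simp add: inner_add_right)
  qed
  have "L \<subseteq> span R"
  proof
    fix z assume z: "z \<in> L"
    obtain p y where py: "p \<in> span R" "\<And>r. r \<in> span R \<Longrightarrow> orthogonal y r" "z = p + y"
      using orthogonal_subspace_decomp_exists[of R z] by metis
    have "y \<bullet> r = 0" if "r \<in> R" for r
      using py(2)[OF span_base[OF that]] by (simp add: orthogonal_def)
    then have "y \<bullet> z = 0"
      by (rule orth[OF _ z])
    moreover have "y \<bullet> p = 0"
      using py(1,2) by (simp add: orthogonal_def)
    ultimately have "y = 0"
      using py(3) by (simp add: inner_add_right)
    with py show "z \<in> span R"
      by simp
  qed
  then show ?thesis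
    by (simp add: root_spanned_def L_def R_def)
qed

section \<open>Slices of normal cones and their extreme points\<close>

text \<open>
  A bounded cross-section of the normal cone of \<open>S\<close> at \<open>x\<close>. That cone may contain lines, so it is first
  cut down to the orthant of \<open>u\<close>.
\<close>

definition sign_slice :: "(real ^ 'n) set \<Rightarrow> real ^ 'n \<Rightarrow> real ^ 'n \<Rightarrow> (real ^ 'n) set" where
  "sign_slice S x u = {w \<in> sum_zero_hyperplane. x \<in> face_max S w \<and>
     (\<forall>i. (u $ i \<ge> 0 \<longrightarrow> w $ i \<ge> 0) \<and> (u $ i \<le> 0 \<longrightarrow> w $ i \<le> 0)) \<and>
     (\<Sum>i | u $ i > 0. w $ i) = 1}"

lemma convex_sign_slice:
  fixes u :: "real ^ 'n"
  shows "convex (sign_slice S x u)"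
proof (rule convexI)
  fix w w' :: "real ^ 'n" and a b :: real
  assume w: "w \<in> sign_slice S x u" and w': "w' \<in> sign_slice S x u"
    and ab: "0 \<le> a" "0 \<le> b" "a + b = 1"
  have "(a *\<^sub>R w + b *\<^sub>R w') \<bullet> y \<le> (a *\<^sub>R w + b *\<^sub>R w') \<bullet> x" if "y \<in> S" for y
    using w w' ab that
    by (auto simp: sign_slice_def face_max_def inner_add_left intro!: add_mono mult_left_mono)
  moreover have "0 \<le> (a *\<^sub>R w + b *\<^sub>R w') $ i" if "u $ i \<ge> 0" for i
    using w w' ab that by (auto simp: sign_slice_def)
  moreover have "(a *\<^sub>R w + b *\<^sub>R w') $ i \<le> 0" if "u $ i \<le> 0" for i
    using w w' ab that by (auto simp: sign_slice_def intro!: add_nonpos_nonpos mult_nonneg_nonpos)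
  ultimately show "a *\<^sub>R w + b *\<^sub>R w' \<in> sign_slice S x u"
    using w w' ab(3)
    by (simp add: sign_slice_def sum_zero_hyperplane_def face_max_def sum.distrib flip: sum_distrib_left)
qed

text \<open>The positive part of a member sums to 1 and, by the zero total, the negative part to -1.
  This bounds the norm by 2, and all defining conditions are closed.\<close>

lemma compact_sign_slice:
  fixes u :: "real ^ 'n"
  shows "compact (sign_slice S x u)"
proof (cases "x \<in> S")
  case False
  then have "sign_slice S x u = {}"
    by (auto simp: sign_slice_def face_max_def)
  then show ?thesis
    by simp
next
  case True
  have "norm w \<le> 2" if w: "w \<in> sign_slice S x u" for w
  proof -
    have "norm w \<le> (\<Sum>i\<in>UNIV. \<bar>w $ i\<bar>)"
      by (rule norm_le_l1_cart)
    also have "\<dots> = (\<Sum>i\<in>UNIV. if u $ i > 0 then 2 * w $ i - w $ i else - w $ i)"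
      using w by (intro sum.cong) (auto simp: sign_slice_def)
    also have "\<dots> = (\<Sum>i\<in>UNIV. (if u $ i > 0 then 2 * w $ i else 0) - w $ i)"
      by (intro sum.cong) auto
    also have "\<dots> = 2 * (\<Sum>i | u $ i > 0. w $ i) - (\<Sum>i\<in>UNIV. w $ i)"
      by (simp add: sum_subtractf sum.If_cases sum_distrib_left)
    also have "\<dots> = 2"
      using w by (simp add: sign_slice_def sum_zero_hyperplane_def)
    finally show ?thesis .
  qed
  then have "bounded (sign_slice S x u)"
    by (auto simp: bounded_iff)
  moreover have "closed (sign_slice S x u)"
  proof -
    have "closed {w :: real ^ 'n. (u $ i \<ge> 0 \<longrightarrow> w $ i \<ge> 0) \<and> (u $ i \<le> 0 \<longrightarrow> w $ i \<le> 0)}" for i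
      by (cases "u $ i \<ge> 0"; cases "u $ i \<le> 0")
        (auto intro!: closed_Collect_le closed_Collect_conj continuous_intros)
    then have "closed {w :: real ^ 'n. \<forall>i. (u $ i \<ge> 0 \<longrightarrow> w $ i \<ge> 0) \<and> (u $ i \<le> 0 \<longrightarrow> w $ i \<le> 0)}"
      by (rule closed_Collect_all)
    moreover have "closed (\<Inter>y\<in>S. {w. w \<bullet> y \<le> w \<bullet> x})"
      by (intro closed_INT ballI closed_Collect_le continuous_intros)
    moreover have "closed {w :: real ^ 'n. (\<Sum>i\<in>UNIV. w $ i) = 0}"
        "closed {w :: real ^ 'n. (\<Sum>i | u $ i > 0. w $ i) = 1}"
      by (intro closed_Collect_eq continuous_intros)+
    ultimately have "closed ({w. (\<Sum>i\<in>UNIV. w $ i) = 0} \<inter> (\<Inter>y\<in>S. {w. w \<bullet> y \<le> w \<bullet> x}) \<inter>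
        {w. \<forall>i. (u $ i \<ge> 0 \<longrightarrow> w $ i \<ge> 0) \<and> (u $ i \<le> 0 \<longrightarrow> w $ i \<le> 0)} \<inter>
        {w. (\<Sum>i | u $ i > 0. w $ i) = 1})"
      by (intro closed_Int)
    moreover have "sign_slice S x u = {w. (\<Sum>i\<in>UNIV. w $ i) = 0} \<inter> (\<Inter>y\<in>S. {w. w \<bullet> y \<le> w \<bullet> x}) \<inter>
        {w. \<forall>i. (u $ i \<ge> 0 \<longrightarrow> w $ i \<ge> 0) \<and> (u $ i \<le> 0 \<longrightarrow> w $ i \<le> 0)} \<inter>
        {w. (\<Sum>i | u $ i > 0. w $ i) = 1}"
      using True unfolding sign_slice_def sum_zero_hyperplane_def face_max_def by blast
    ultimately show ?thesis
      by simp
  qed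
  ultimately show ?thesis
    by (simp add: compact_eq_bounded_closed)
qed

text \<open>Otherwise \<open>w\<close> would be the midpoint of two points
  \<open>w + s *\<^sub>R z\<close> of the slice with opposite small \<open>s\<close>. Hence
  \<open>const_dirs S w\<close> is at most one-dimensional.\<close>

lemma extreme_sign_slice_const_dirs:
  assumes S: "polytope S" and w: "w extreme_point_of sign_slice S x u"
    and z: "z \<in> const_dirs S w" and z1: "(\<Sum>i | u $ i > 0. z $ i) = 0"
  shows "z = 0"
proof (rule ccontr)
  assume "z \<noteq> 0"
  have wB: "w \<in> sign_slice S x u"
    using w by (simp add: extreme_point_of_def)
  then have xF: "x \<in> face_max S w"
    by (simp add: sign_slice_def)
  have "\<forall>\<^sub>F s in nhds (0::real). x \<in> face_max S (w + s *\<^sub>R z)"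
    using z xF by (intro eventually_face_max_perturb S) (auto intro: const_dirs_inner_eq)
  moreover have "\<forall>\<^sub>F s in nhds (0::real). \<forall>v. sgn ((w + s *\<^sub>R z) $ v) = sgn (w $ v)"
    using z by (intro eventually_same_sign) (auto simp: const_dirs_def)
  ultimately have "\<forall>\<^sub>F s in nhds (0::real). w + s *\<^sub>R z \<in> sign_slice S x u"
  proof eventually_elim
    case (elim s)
    have pos: "(w + s *\<^sub>R z) $ v \<ge> 0 \<longleftrightarrow> w $ v \<ge> 0" for v
      using elim(2) by (metis zero_le_sgn_iff)
    have neg: "(w + s *\<^sub>R z) $ v \<le> 0 \<longleftrightarrow> w $ v \<le> 0" for v
      using elim(2) by (metis sgn_le_0_iff)
    have "(\<Sum>i\<in>UNIV. (w + s *\<^sub>R z) $ i) = 0"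
      using wB z by (simp add: sign_slice_def const_dirs_def sum_zero_hyperplane_def sum.distrib
          flip: sum_distrib_left)
    moreover have "(\<Sum>i | u $ i > 0. (w + s *\<^sub>R z) $ i) = 1"
      using wB z1 by (simp add: sign_slice_def sum.distrib flip: sum_distrib_left)
    ultimately show ?case
      using wB elim(1) pos neg
      unfolding sign_slice_def sum_zero_hyperplane_def mem_Collect_eq by blast
  qed
  then obtain e where e: "e > 0" "\<And>s. dist s 0 < e \<Longrightarrow> w + s *\<^sub>R z \<in> sign_slice S x u"
    unfolding eventually_nhds_metric by blast
  define a b where "a = w + (e / 2) *\<^sub>R z" and "b = w + (- (e / 2)) *\<^sub>R z"
  have "a \<in> sign_slice S x u" "b \<in> sign_slice S x u"
    unfolding a_def b_def by (intro e(2); use e(1) in simp)+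
  moreover have "midpoint a b = w"
    by (simp add: midpoint_def a_def b_def algebra_simps flip: scaleR_2)
  moreover have "a \<noteq> b"
  proof
    assume "a = b"
    then have "e *\<^sub>R z = 0"
      by (simp add: a_def b_def algebra_simps flip: scaleR_add_left)
    with \<open>z \<noteq> 0\<close> e(1) show False by simp
  qed
  ultimately show False
    using w midpoint_in_open_segment[of a b] unfolding extreme_point_of_def by metis
qed

section \<open>The sum of three polytopes\<close>

text \<open>The sum is compared with the set cut out by its own maxima in root directions. A point
  \<open>m\<close> of that set outside the sum is separated by some \<open>u\<close>; but
  \<open>u\<close> is a nonnegative combination of roots maximised at the same point as
  \<open>u\<close>, and \<open>m\<close> violates none of their bounds.\<close>

lemma alcoved_sum3:
  fixes P Q R :: "(real ^ 'n) set"
  assumes PQ: "compatible P Q" and PR: "compatible P R" and QR: "compatible Q R"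
  shows "alcoved (P + Q + R)"
proof (cases "P = {} \<or> Q = {} \<or> R = {}")
  case True
  then show ?thesis
    using PQ QR by (auto simp: compatible_def)
next
  case False
  then have ne: "P \<noteq> {}" "Q \<noteq> {}" "R \<noteq> {}"
    by auto
  have alc: "alcoved P" "alcoved Q" "alcoved R" "alcoved (P + Q)" "alcoved (P + R)" "alcoved (Q + R)"
    using PQ PR QR by (auto simp: compatible_def)
  note poly = alc[THEN alcoved_imp_polytope]
  note comp = poly[THEN polytope_imp_compact]
  define S where "S = P + Q + R"
  have ne2: "P + Q \<noteq> {}" "P + R \<noteq> {}" "Q + R \<noteq> {}"
    using ne by (auto simp: set_plus_def)
  then have neS: "S \<noteq> {}"
    using ne by (auto simp: S_def set_plus_def)
  have polyS: "polytope S"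
    by (simp add: S_def polytope_plus poly)
  have SH: "S \<subseteq> sum_zero_hyperplane"
    using alc(3,4) by (force simp: S_def alcoved_def sum_zero_hyperplane_def sum.distrib elim!: set_plus_elim)
  have extreme: "\<exists>c i j. c > 0 \<and> i \<noteq> j \<and> rootv i j = c *\<^sub>R w"
    if w: "w extreme_point_of sign_slice S x u" for w x u
  proof -
    have wB: "w \<in> sign_slice S x u"
      using w by (simp add: extreme_point_of_def)
    then have wH: "w \<in> sum_zero_hyperplane" and w1: "(\<Sum>i | u $ i > 0. w $ i) = 1"
      by (auto simp: sign_slice_def)
    then have "w \<noteq> 0"
      by auto
    have inter: "const_dirs P w \<inter> const_dirs Q w = const_dirs (P + Q) w"
        "const_dirs P w \<inter> const_dirs R w = const_dirs (P + R) w"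
        "const_dirs Q w \<inter> const_dirs R w = const_dirs (Q + R) w"
      by (simp_all add: const_dirs_plus comp ne)
    have inter3: "const_dirs P w \<inter> const_dirs Q w \<inter> const_dirs R w = const_dirs S w"
      by (simp add: S_def const_dirs_plus comp ne ne2)
    have spanned: "root_spanned (const_dirs P w \<inter> const_dirs Q w)"
        "root_spanned (const_dirs P w \<inter> const_dirs R w)" "root_spanned (const_dirs Q w \<inter> const_dirs R w)"
      by (simp_all add: inter alcoved_root_spanned alc ne2 wH)
    have "w \<in> const_dirs P w \<inter> const_dirs Q w \<inter> const_dirs R w"
      by (simp add: self_in_const_dirs wH)
    then obtain i j where "i \<noteq> j" "rootv i j \<in> const_dirs P w \<inter> const_dirs Q w \<inter> const_dirs R w"
      using common_root[OF subspace_const_dirs subspace_const_dirs subspace_const_dirs spanned _ \<open>w \<noteq> 0\<close>]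
      by metis
    with inter3 have ij: "i \<noteq> j" "rootv i j \<in> const_dirs S w"
      by auto
    \<comment> \<open>Chosen so that \<open>rootv i j - c *\<^sub>R w\<close> has sum zero over the
      positive part of \<open>u\<close>, as extremality requires.\<close>
    define c where "c = (\<Sum>k | u $ k > 0. rootv i j $ k)"
    have "rootv i j - c *\<^sub>R w \<in> const_dirs S w"
      by (intro subspace_diff subspace_scale subspace_const_dirs ij self_in_const_dirs wH)
    moreover have "(\<Sum>k | u $ k > 0. (rootv i j - c *\<^sub>R w) $ k) = 0"
      by (simp add: sum_subtractf c_def w1 flip: sum_distrib_left)
    ultimately have "rootv i j - c *\<^sub>R w = 0"
      by (rule extreme_sign_slice_const_dirs[OF polyS w])
    then have eq: "rootv i j = c *\<^sub>R w"
      by simp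
    \<comment> \<open>Exchanging \<open>i\<close> and \<open>j\<close> reverses the sign of the
      factor, so it can be made positive.\<close>
    then have "rootv j i = (- c) *\<^sub>R w"
      by (metis scaleR_minus_left uminus_root)
    moreover have "c \<noteq> 0"
      using eq root_neq_0[OF ij(1)] by auto
    ultimately show ?thesis
      using eq ij(1) by (metis linorder_neqE_linordered_idom neg_0_less_iff_less)
  qed
  have "\<exists>y. y \<in> face_max S (rootv i j)" for i j
    using face_max_nonempty[OF polytope_imp_compact[OF polyS] neS] by blast
  then obtain top where top: "\<And>i j. top i j \<in> face_max S (rootv i j)"
    by metis
  define a where "a i j = rootv i j \<bullet> top i j" for i j
  have "S = {x \<in> sum_zero_hyperplane. \<forall>i j. i \<noteq> j \<longrightarrow> x $ i - x $ j \<le> a i j}" (is "_ = ?M")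
  proof
    show "S \<subseteq> ?M"
      using SH top by (auto simp: a_def face_max_def simp flip: inner_root)
    show "?M \<subseteq> S"
    proof (rule ccontr)
      assume "\<not> ?M \<subseteq> S"
      then obtain m where mH: "m \<in> sum_zero_hyperplane" and ma: "\<And>i j. i \<noteq> j \<Longrightarrow> rootv i j \<bullet> m \<le> a i j"
        and mS: "m \<notin> S"
        by (auto simp: inner_root)
      obtain f b where fb: "f \<bullet> m < b" "\<And>y. y \<in> S \<Longrightarrow> b < f \<bullet> y"
        using separating_hyperplane_closed_point[OF polytope_imp_convex[OF polyS] polytope_imp_closed[OF polyS] mS]
        by blast
      \<comment> \<open>Subtracting the mean of \<open>f\<close> gives a normal vector of sum zero
        with the same values on the hyperplane; the sign is flipped to turn separation into a
        maximum.\<close>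
      define c where "c = (\<Sum>k\<in>UNIV. f $ k) / real CARD('n)"
      define u where "u = (\<chi> i. c - f $ i)"
      have uH: "u \<in> sum_zero_hyperplane"
        by (simp add: u_def c_def sum_zero_hyperplane_def sum_subtractf)
      have u_inner: "u \<bullet> y = - (f \<bullet> y)" if "y \<in> sum_zero_hyperplane" for y
        using that by (simp add: u_def inner_vec_def sum_zero_hyperplane_def left_diff_distrib sum_subtractf
            flip: sum_distrib_left)
      obtain x where x: "x \<in> face_max S u"
        using face_max_nonempty[OF polytope_imp_compact[OF polyS] neS, of u] by blast
      then have "x \<in> S"
        by (simp add: face_max_def)
      then have um: "u \<bullet> x < u \<bullet> m"
        using u_inner mH SH fb by (metis less_trans neg_less_iff_less subsetD)
      \<comment> \<open>Taken at a maximiser \<open>x\<close> of \<open>u\<close> and in the orthant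
        of \<open>u\<close>, so that a positive multiple of \<open>u\<close> lies in
        \<open>B\<close>.\<close>
      define B where "B = sign_slice S x u"
      have "B = convex hull {w. w extreme_point_of B}"
        unfolding B_def by (intro Krein_Milman_Minkowski compact_sign_slice convex_sign_slice)
      moreover have "w \<bullet> (m - x) \<le> 0" if w: "w extreme_point_of B" for w
      proof -
        obtain c i j where cij: "c > 0" "i \<noteq> j" "rootv i j = c *\<^sub>R w"
          using extreme w unfolding B_def by blast
        have "x \<in> face_max S w"
          using w by (simp add: B_def extreme_point_of_def sign_slice_def)
        then have "x \<in> face_max S (rootv i j)"
          by (simp add: cij face_max_scale)
        then have "rootv i j \<bullet> m \<le> rootv i j \<bullet> x"
          using ma[OF cij(2)] inner_face_max_eq[OF top] by (simp add: a_def)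
        then show ?thesis
          using cij(1) by (simp add: cij(3) inner_diff_right)
      qed
      then have "convex hull {w. w extreme_point_of B} \<subseteq> {w. (m - x) \<bullet> w \<le> 0}"
        by (intro hull_minimal convex_halfspace_le) (auto simp: inner_commute)
      ultimately have B: "(m - x) \<bullet> w \<le> 0" if "w \<in> B" for w
        using that by blast
      \<comment> \<open>The factor normalising \<open>u\<close> into the slice; it is positive, as
        otherwise \<open>u\<close> would vanish and not separate \<open>m\<close>.\<close>
      define t where "t = (\<Sum>i | u $ i > 0. u $ i)"
      have "t > 0"
      proof (rule ccontr)
        assume "\<not> t > 0"
        have "u $ i \<le> 0" for i
        proof (rule ccontr)
          assume "\<not> u $ i \<le> 0"
          then have "t > 0"
            unfolding t_def by (intro sum_pos2[of _ i]) auto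
          with \<open>\<not> t > 0\<close> show False by simp
        qed
        moreover have "(\<Sum>i\<in>UNIV. - u $ i) = 0"
          using uH by (simp add: sum_zero_hyperplane_def sum_negf)
        ultimately have "\<forall>i. u $ i = 0"
          using sum_nonneg_eq_0_iff[of UNIV "\<lambda>i. - u $ i"] by simp
        then have "u = 0"
          by (simp add: vec_eq_iff)
        with um show False by simp
      qed
      have "(1 / t) *\<^sub>R u \<in> B"
        using \<open>t > 0\<close> uH x
        by (auto simp: B_def sign_slice_def sum_zero_hyperplane_def face_max_scale t_def
            divide_nonpos_pos simp flip: sum_divide_distrib)
      then have "(m - x) \<bullet> u \<le> 0"
        using B[of "(1 / t) *\<^sub>R u"] \<open>t > 0\<close> by (simp add: divide_le_0_iff)
      with um show False
        by (simp add: inner_diff_left inner_commute[of u])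
    qed
  qed
  with polyS SH have "alcoved S"
    unfolding alcoved_def by (intro conjI exI[of _ a])
  then show ?thesis
    by (simp add: S_def)
qed

section \<open>Arbitrarily many summands\<close>

text \<open>The summands are absorbed into \<open>Q\<close> one at a time; the case of three
  polytopes shows that \<open>Q + P j\<close> stays compatible with the remaining ones.\<close>

lemma alcoved_sum_compatible:
  assumes "finite I" "alcoved Q" "\<And>i. i \<in> I \<Longrightarrow> compatible Q (P i)"
    and "\<And>i j. i \<in> I \<Longrightarrow> j \<in> I \<Longrightarrow> i \<noteq> j \<Longrightarrow> compatible (P i) (P j)"
  shows "alcoved (Q + (\<Sum>i\<in>I. P i))"
  using assms
proof (induction I arbitrary: Q rule: finite_induct)
  case empty
  then show ?case
    by simp
next
  case (insert j I)
  have "compatible (Q + P j) (P i)" if "i \<in> I" for i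
  proof -
    have c: "compatible Q (P j)" "compatible Q (P i)" "compatible (P j) (P i)"
      using insert that by auto
    then show ?thesis
      using alcoved_sum3[OF c] by (simp add: compatible_def)
  qed
  then have "alcoved ((Q + P j) + (\<Sum>i\<in>I. P i))"
    using insert by (intro insert.IH) (auto simp: compatible_def)
  then show ?case
    using insert by (simp add: add.assoc)
qed

text \<open>This is the neutral first summand for the induction and covers the empty sum.
  Differences bounded by 0 make all coordinates equal, hence zero.\<close>

lemma alcoved_zero: "alcoved {0 :: real ^ 'n}"
proof -
  have "x = 0" if "x \<in> sum_zero_hyperplane" "\<forall>i j. i \<noteq> j \<longrightarrow> x $ i - x $ j \<le> 0" for x :: "real ^ 'n"
  proof -
    have eq: "x $ i = x $ j" for i j
      using that(2) by (metis antisym diff_le_0_iff_le)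
    have "x $ i = 0" for i
    proof -
      have "(\<Sum>j\<in>(UNIV :: 'n set). x $ i) = (\<Sum>j\<in>UNIV. x $ j)"
        by (intro sum.cong eq refl)
      also have "\<dots> = 0"
        using that(1) by (simp add: sum_zero_hyperplane_def)
      finally have "(\<Sum>j\<in>(UNIV :: 'n set). x $ i) = 0" .
      then show ?thesis by simp
    qed
    then show ?thesis
      by (simp add: vec_eq_iff)
  qed
  then have "{0 :: real ^ 'n} = {x \<in> sum_zero_hyperplane. \<forall>i j. i \<noteq> j \<longrightarrow> x $ i - x $ j \<le> 0}"
    by (auto simp: sum_zero_hyperplane_def)
  moreover have "polytope {0 :: real ^ 'n}"
    by (rule polytope_sing)
  ultimately show ?thesis
    unfolding alcoved_def by (intro conjI exI[of _ "\<lambda>_ _. 0"]) (auto simp: sum_zero_hyperplane_def)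
qed

theorem theoremA:
  fixes P :: "nat \<Rightarrow> (real ^ 'n) set" and k :: nat
  assumes "CARD('n) \<ge> 2"
    and "\<And>i. i \<in> {1..k} \<Longrightarrow> alcoved (P i)"
    and "\<And>i j. i \<in> {1..k} \<Longrightarrow> j \<in> {1..k} \<Longrightarrow> i \<noteq> j \<Longrightarrow> compatible (P i) (P j)"
  shows "alcoved (\<Sum>i\<in>{1..k}. P i)"
proof -
  have "compatible {0} (P i)" if "i \<in> {1..k}" for i
    using assms(2)[OF that] by (simp add: compatible_def alcoved_zero)
  then have "alcoved ({0} + (\<Sum>i\<in>{1..k}. P i))"
    using assms(3) by (intro alcoved_sum_compatible alcoved_zero) auto
  then show ?thesis
    by simp
qed

end
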